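(* Let $L\ge 0$, $\alpha>0$, $\mu_0>0$, $\gamma>0$, $t_0\in\mathbb{R}$, let $\mu_k=\mu_0(k+1)^{-\gamma}$ for $k\ge 0$, and let $(t_k)_{k\ge 0}$ be defined by $t_{k+1}-t_k=\dfrac{1}{L+\alpha/\mu_k}$. Write $\mu(t_k)=\mu_k$. Then for every $k\ge 1$ the following hold. (1) If $\gamma\ne 1$: $$(L+\alpha\mu_0^{-1})^{-1}(1-\gamma)^{-1}[(k+1)^{1-\gamma}-1]\le t_k-t_0\le(\alpha\mu_0^{-1})^{-1}(1-\gamma)^{-1}[k^{1-\gamma}-\gamma],$$ $$[\alpha\mu_0^{-1}(1-\gamma)(t_k-t_0)+\gamma]^{(1-\gamma)^{-1}}\le k\le[(L+\alpha\mu_0^{-1})(1-\gamma)(t_k-t_0)+1]^{(1-\gamma)^{-1}}-1,$$ $$\mu_0[(L+\alpha\mu_0^{-1})(1-\gamma)(t_k-t_0)+1]^{-\frac{\gamma}{1-\gamma}}\le\mu(t_k)\le\mu_0\left([\alpha\mu_0^{-1}(1-\gamma)(t_k-t_0)+\gamma]^{(1-\gamma)^{-1}}+1\right)^{-\gamma}.$$ (2) If $\gamma=1$: $$(L+\alpha\mu_0^{-1})^{-1}\log(k+1)\le t_k-t_0\le(\alpha\mu_0^{-1})^{-1}(1+\log k),$$ $$\exp(\alpha\mu_0^{-1}(t_k-t_0)-1)\le k\le\exp((L+\alpha\mu_0^{-1})(t_k-t_0))-1,$$ $$\mu_0\exp(-(L+\alpha\mu_0^{-1})(t_k-t_0))\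le\mu(t_k)\le\mu_0\left[\exp(\alpha\mu_0^{-1}(t_k-t_0)-1)+1\right]^{-1}.$$
   Context: Here $t_k$ are the discretized time points of the forward Euler scheme with step $s_k=t_{k+1}-t_k=1/(L+\alpha/\mu(t_k))$, where $L$ is a smoothness constant and $\alpha$ a smoothing constant; only the recursion in the claim is needed.
   Formalization: For γ>1, with B=(L+α/μ₀)(1−γ)(t_k−t_0)+1, the upper bound on k is claimed only if B>0 and the lower bound on μ(t_k) only if B≥0; otherwise the real power is undefined or the bound can fail (L=0, α=μ₀, γ=2, k=2). *)

theory Defs
  imports Complex_Main
begin

text \<open>
  Real powers x^p with arbitrary real exponent are written with the library's \<open>powr\<close>, which is
  the mathematical power only where that is defined: for x > 0, and for x = 0 with p > 0 (giving 0).
  For an exponent \<open>\<gamma> > 1\<close> the quantity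
  \<open>B = (L + \<alpha> \<mu>\<^sub>0\<^sup>-\<^sup>1) (1 - \<gamma>) (t\<^sub>k - t\<^sub>0) + 1\<close> can be zero or negative: with
  \<open>L = 0\<close>, \<open>\<alpha> = \<mu>\<^sub>0\<close>, \<open>\<gamma> = 2\<close> one gets \<open>B = 0\<close> for \<open>k = 1\<close> and \<open>B = -1/4\<close> for \<open>k = 2\<close>.
  The two bounds that involve powers of B (the upper bound on k, with exponent
  \<open>1/(1-\<gamma>)\<close>, and the lower bound on \<open>\<mu>\<^sub>k\<close>, with exponent \<open>-\<gamma>/(1-\<gamma>)\<close>) are
  therefore claimed for all \<open>\<gamma> < 1\<close>, and for \<open>\<gamma> > 1\<close> whenever the respective power of B is
  defined. The bases of all other powers are always positive.
\<close>

end

theory Submission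
  imports Defs
begin

text \<open>
  Put \<open>a = \<alpha> / \<mu>0\<close>, \<open>A = L + a\<close> and \<open>D = t k - t 0\<close>. The recursion says
  \<open>t (Suc j) - t j = 1 / (L + a (j + 1)\<^sup>\<gamma>)\<close>, and since \<open>(j + 1)\<^sup>\<gamma> \<ge> 1\<close> this step
  lies between \<open>(j + 1)\<^sup>-\<^sup>\<gamma> / A\<close> and \<open>(j + 1)\<^sup>-\<^sup>\<gamma> / a\<close>. So \<open>D\<close> is compared with
  the partial sums of \<open>\<Sum> j\<^sup>-\<^sup>\<gamma>\<close>, and these with the integral \<open>H x\<close> of
  \<open>y\<^sup>-\<^sup>\<gamma>\<close> from \<open>1\<close> to \<open>x\<close>, which is \<open>ln x\<close> or
  \<open>(x\<^sup>1\<^sup>-\<^sup>\<gamma> - 1) / (1 - \<gamma>)\<close>. This gives \<open>H (k + 1) / A \<le> D \<le> (1 + H k) / a\<close>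
  for \<open>\<gamma> = 1\<close> and \<open>\<gamma> \<noteq> 1\<close> alike (\<open>time_bounds\<close>).

  The bounds on \<open>k\<close> come from solving these two inequalities for \<open>k\<close>, and those on \<open>\<mu> k\<close> from
  applying the decreasing map \<open>x \<mapsto> \<mu>0 (x + 1)\<^sup>-\<^sup>\<gamma>\<close> to the bounds on \<open>k\<close>. When \<open>\<gamma> > 1\<close>,
  multiplication by \<open>1 - \<gamma>\<close> and the power \<open>1 / (1 - \<gamma>)\<close> each reverse the order, so
  the conclusions have the same direction as for \<open>\<gamma> < 1\<close>; but then \<open>A (1 - \<gamma>) D + 1\<close> is only
  bounded from above, and its sign has to be assumed.
\<close>

text \<open>
  The primitive of \<open>x\<^sup>-\<^sup>\<gamma>\<close> that vanishes at \<open>1\<close>.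
\<close>
definition power_integral :: "real \<Rightarrow> real \<Rightarrow> real" where
  "power_integral \<gamma> x = (if \<gamma> = 1 then ln x else (x powr (1 - \<gamma>) - 1) / (1 - \<gamma>))"

lemma power_integral_1 [simp]: "power_integral \<gamma> 1 = 0"
  by (simp add: power_integral_def)

lemma power_integral_has_derivative:
  assumes "x > 0"
  shows "(power_integral \<gamma> has_real_derivative x powr (- \<gamma>)) (at x)"
proof (cases "\<gamma> = 1")
  case True
  have "(ln has_real_derivative x powr (- \<gamma>)) (at x)"
    using assms True by (auto intro!: derivative_eq_intros simp: powr_minus divide_simps)
  then show ?thesis
    using True by (simp add: power_integral_def [abs_def])
next
  case False
  have "((\<lambda>x. (x powr (1 - \<gamma>) - 1) / (1 - \<gamma>)) has_real_derivative x powr (- \<gamma>)) (at x)"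
    using assms False by (auto intro!: derivative_eq_intros)
  then show ?thesis
    using False by (simp add: power_integral_def [abs_def])
qed

text \<open>
  The integral test on one unit interval: by the mean value theorem the increment is
  \<open>z\<^sup>-\<^sup>\<gamma>\<close> for some \<open>z\<close> between \<open>x\<close> and \<open>x + 1\<close>.
\<close>
lemma power_integral_increment:
  assumes "x > 0" and "\<gamma> \<ge> 0"
  shows "(x + 1) powr (- \<gamma>) \<le> power_integral \<gamma> (x + 1) - power_integral \<gamma> x"
    and "power_integral \<gamma> (x + 1) - power_integral \<gamma> x \<le> x powr (- \<gamma>)"
proof -
  obtain z where z: "x < z" "z < x + 1"
    "power_integral \<gamma> (x + 1) - power_integral \<gamma> x = (x + 1 - x) * z powr (- \<gamma>)"
    using MVT2 [of x "x + 1" "power_integral \<gamma>" "\<lambda>y. y powr (- \<gamma>)"]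
      power_integral_has_derivative assms by force
  show "(x + 1) powr (- \<gamma>) \<le> power_integral \<gamma> (x + 1) - power_integral \<gamma> x"
    using z assms by (auto intro!: powr_mono2')
  show "power_integral \<gamma> (x + 1) - power_integral \<gamma> x \<le> x powr (- \<gamma>)"
    using z assms by (auto intro!: powr_mono2')
qed

text \<open>
  The upper bound starts at \<open>k = 1\<close>: the first term of the sum, \<open>1\<close>, is kept apart because
  the integral that would dominate it, from \<open>0\<close> to \<open>1\<close>, diverges for \<open>\<gamma> \<ge> 1\<close>.
\<close>
lemma time_bounds:
  fixes a L \<gamma> :: real and t :: "nat \<Rightarrow> real"
  assumes "L \<ge> 0" "a > 0" "\<gamma> \<ge> 0"
    and step: "\<And>k. t (Suc k) - t k = 1 / (L + a * (real k + 1) powr \<gamma>)"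
  shows "power_integral \<gamma> (real k + 1) \<le> (L + a) * (t k - t 0)"
    and "k \<ge> 1 \<Longrightarrow> a * (t k - t 0) \<le> 1 + power_integral \<gamma> (real k)"
proof -
  have step_lower: "(real j + 1) powr (- \<gamma>) \<le> (L + a) * (t (Suc j) - t j)" for j
  proof -
    define p where "p = (real j + 1) powr \<gamma>"
    have p: "p \<ge> 1" unfolding p_def using assms by (intro ge_one_powr_ge_zero) auto
    have pos: "L + a * p > 0" using assms p by (intro add_nonneg_pos) auto
    have "L * 1 \<le> L * p" using assms p by (intro mult_left_mono) auto
    then have "1 / p \<le> (L + a) / (L + a * p)"
      using p pos by (simp add: divide_simps algebra_simps)
    then show ?thesis using step [of j] by (simp add: p_def powr_minus inverse_eq_divide)
  qed
  have step_upper: "a * (t (Suc j) - t j) \<le> (real j + 1) powr (- \<gamma>)" for j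
  proof -
    define p where "p = (real j + 1) powr \<gamma>"
    have p: "p > 0" by (simp add: p_def)
    have pos: "L + a * p > 0" using assms p by (intro add_nonneg_pos) auto
    have "a / (L + a * p) \<le> 1 / p"
      using p pos assms by (simp add: divide_simps algebra_simps)
    then show ?thesis using step [of j] by (simp add: p_def powr_minus inverse_eq_divide)
  qed
  show "power_integral \<gamma> (real k + 1) \<le> (L + a) * (t k - t 0)"
  proof (induction k)
    case 0
    then show ?case by simp
  next
    case (Suc k)
    show ?case
      using Suc step_lower [of k] power_integral_increment(2) [of "real k + 1" \<gamma>] assms
      by (simp add: algebra_simps)
  qed
  assume "k \<ge> 1"
  then show "a * (t k - t 0) \<le> 1 + power_integral \<gamma> (real k)"
  proof (induction k rule: dec_induct)
    case base
    then show ?case using step_upper [of 0] by simp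
  next
    case (step k)
    then show ?case
      using step_upper [of k] power_integral_increment(1) [of "real k" \<gamma>] assms
      by (simp add: algebra_simps)
  qed
qed

text \<open>
  Both \<open>u \<mapsto> u / q\<close> and \<open>u \<mapsto> u powr inverse q\<close> are increasing for \<open>q > 0\<close> and
  decreasing for \<open>q < 0\<close>. Undoing the division and taking the root therefore reverse the
  order either both or not at all.
\<close>
lemma root_le_if_divide_le:
  fixes q x y :: real
  assumes "q \<noteq> 0" "x > 0" "y > 0" "y / q \<le> x powr q / q"
  shows "y powr inverse q \<le> x"
proof -
  have eq: "(x powr q) powr inverse q = x" using assms by (simp add: powr_powr)
  show ?thesis
  proof (cases "q > 0")
    case True
    then have "y \<le> x powr q" using assms by (simp add: divide_simps)
    then have "y powr inverse q \<le> (x powr q) powr inverse q"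
      using assms True by (intro powr_mono2) auto
    with eq show ?thesis by simp
  next
    case False
    then have "x powr q \<le> y" using assms by (simp add: divide_simps split: if_splits)
    then have "y powr inverse q \<le> (x powr q) powr inverse q"
      using assms False by (intro powr_mono2') auto
    with eq show ?thesis by simp
  qed
qed

text \<open>
  Here \<open>y \<ge> x powr q > 0\<close> is automatic for \<open>q > 0\<close>, but for \<open>q < 0\<close> the inequality
  bounds \<open>y\<close> only from above.
\<close>
lemma le_root_if_divide_le:
  fixes q x y :: real
  assumes "q \<noteq> 0" "x > 0" "q > 0 \<or> y > 0" "x powr q / q \<le> y / q"
  shows "x \<le> y powr inverse q"
proof -
  have eq: "(x powr q) powr inverse q = x" using assms by (simp add: powr_powr)
  show ?thesis
  proof (cases "q > 0")
    case True
    then have "x powr q \<le> y" using assms by (simp add: divide_simps)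
    then have "(x powr q) powr inverse q \<le> y powr inverse q"
      using assms True by (intro powr_mono2) auto
    with eq show ?thesis by simp
  next
    case False
    then have "y \<le> x powr q" using assms by (simp add: divide_simps split: if_splits)
    then have "(x powr q) powr inverse q \<le> y powr inverse q"
      using assms False by (intro powr_mono2') auto
    with eq show ?thesis by simp
  qed
qed

theorem proposition3:
  fixes L \<alpha> \<mu>0 \<gamma> :: real and \<mu> t :: "nat \<Rightarrow> real"
  assumes "L \<ge> 0" and "\<alpha> > 0" and "\<mu>0 > 0" and "\<gamma> > 0"
    and "\<And>k. \<mu> k = \<mu>0 * (real k + 1) powr (- \<gamma>)"
    and "\<And>k. t (Suc k) - t k = 1 / (L + \<alpha> / \<mu> k)"
  shows "\<forall>k\<ge>1.
    (\<gamma> \<noteq> 1 \<longrightarrow>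
       inverse (L + \<alpha> * inverse \<mu>0) * inverse (1 - \<gamma>) * ((real k + 1) powr (1 - \<gamma>) - 1) \<le> t k - t 0
     \<and> t k - t 0 \<le> inverse (\<alpha> * inverse \<mu>0) * inverse (1 - \<gamma>) * (real k powr (1 - \<gamma>) - \<gamma>)
     \<and> (\<alpha> * inverse \<mu>0 * (1 - \<gamma>) * (t k - t 0) + \<gamma>) powr inverse (1 - \<gamma>) \<le> real k
     \<and> (\<gamma> < 1 \<or> (L + \<alpha> * inverse \<mu>0) * (1 - \<gamma>) * (t k - t 0) + 1 > 0 \<longrightarrow>
          real k \<le> ((L + \<alpha> * inverse \<mu>0) * (1 - \<gamma>) * (t k - t 0) + 1) powr inverse (1 - \<gamma>) - 1)
     \<and> (\<gamma> < 1 \<or> (L + \<alpha> * inverse \<mu>0) * (1 - \<gamma>) * (t k - t 0) + 1 \<ge> 0 \<longrightarrow>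
          \<mu>0 * ((L + \<alpha> * inverse \<mu>0) * (1 - \<gamma>) * (t k - t 0) + 1) powr (- (\<gamma> / (1 - \<gamma>))) \<le> \<mu> k)
     \<and> \<mu> k \<le> \<mu>0 * ((\<alpha> * inverse \<mu>0 * (1 - \<gamma>) * (t k - t 0) + \<gamma>) powr inverse (1 - \<gamma>) + 1) powr (- \<gamma>))
  \<and> (\<gamma> = 1 \<longrightarrow>
       inverse (L + \<alpha> * inverse \<mu>0) * ln (real k + 1) \<le> t k - t 0
     \<and> t k - t 0 \<le> inverse (\<alpha> * inverse \<mu>0) * (1 + ln (real k))
     \<and> exp (\<alpha> * inverse \<mu>0 * (t k - t 0) - 1) \<le> real k
     \<and> real k \<le> exp ((L + \<alpha> * inverse \<mu>0) * (t k - t 0)) - 1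
     \<and> \<mu>0 * exp (- ((L + \<alpha> * inverse \<mu>0) * (t k - t 0))) \<le> \<mu> k
     \<and> \<mu> k \<le> \<mu>0 * inverse (exp (\<alpha> * inverse \<mu>0 * (t k - t 0) - 1) + 1))"
proof (intro allI impI)
  fix k :: nat
  assume k: "k \<ge> 1"
  define a where "a = \<alpha> * inverse \<mu>0"
  define A where "A = L + a"
  define D where "D = t k - t 0"
  have a: "a > 0" and A: "A > 0"
    using assms(1-3) by (auto simp: a_def A_def intro: add_nonneg_pos)
  have mu: "\<mu> k = \<mu>0 * (real k + 1) powr (- \<gamma>)"
    by (rule assms(5))
  have step: "t (Suc j) - t j = 1 / (L + a * (real j + 1) powr \<gamma>)" for j
    using assms(3) by (simp add: assms(5,6) a_def powr_minus divide_simps)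
  have lower: "power_integral \<gamma> (real k + 1) \<le> A * D"
    and upper: "a * D \<le> 1 + power_integral \<gamma> (real k)"
    using time_bounds [of L a \<gamma> t k] assms(1,4) a step k by (auto simp: A_def D_def)
  have D: "D > 0"
  proof -
    have "(L + a * (real j + 1) powr \<gamma>) > 0" for j
      using assms(1) a by (intro add_nonneg_pos) auto
    then have "t (Suc j) - t j > 0" for j
      by (simp only: step zero_less_divide_1_iff)
    then have "strict_mono t" by (simp add: strict_mono_Suc_iff)
    then show ?thesis using k by (simp add: D_def strict_mono_less)
  qed
  have mu_upper: "\<mu> k \<le> \<mu>0 * (x + 1) powr (- \<gamma>)" if "0 \<le> x" "x \<le> real k" for x
    unfolding mu using that assms(3,4) by (intro mult_left_mono powr_mono2') auto
  \<comment> \<open>On export the local definitions unfold, which turns this into the original claim.\<close>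
  show "(\<gamma> \<noteq> 1 \<longrightarrow>
      inverse A * inverse (1 - \<gamma>) * ((real k + 1) powr (1 - \<gamma>) - 1) \<le> D
      \<and> D \<le> inverse a * inverse (1 - \<gamma>) * (real k powr (1 - \<gamma>) - \<gamma>)
      \<and> (a * (1 - \<gamma>) * D + \<gamma>) powr inverse (1 - \<gamma>) \<le> real k
      \<and> (\<gamma> < 1 \<or> A * (1 - \<gamma>) * D + 1 > 0 \<longrightarrow>
          real k \<le> (A * (1 - \<gamma>) * D + 1) powr inverse (1 - \<gamma>) - 1)
      \<and> (\<gamma> < 1 \<or> A * (1 - \<gamma>) * D + 1 \<ge> 0 \<longrightarrow>
          \<mu>0 * (A * (1 - \<gamma>) * D + 1) powr (- (\<gamma> / (1 - \<gamma>))) \<le> \<mu> k)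
      \<and> \<mu> k \<le> \<mu>0 * ((a * (1 - \<gamma>) * D + \<gamma>) powr inverse (1 - \<gamma>) + 1) powr (- \<gamma>))
    \<and> (\<gamma> = 1 \<longrightarrow>
      inverse A * ln (real k + 1) \<le> D
      \<and> D \<le> inverse a * (1 + ln (real k))
      \<and> exp (a * D - 1) \<le> real k
      \<and> real k \<le> exp (A * D) - 1
      \<and> \<mu>0 * exp (- (A * D)) \<le> \<mu> k
      \<and> \<mu> k \<le> \<mu>0 * inverse (exp (a * D - 1) + 1))"
    (is "(_ \<longrightarrow> ?power) \<and> (_ \<longrightarrow> ?log)")
  proof (rule conjI; rule impI)
    assume ne: "\<gamma> \<noteq> 1"
    define q where "q = 1 - \<gamma>"
    define F where "F = a * q * D + \<gamma>"
    define G where "G = A * q * D + 1"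
    have q: "q \<noteq> 0" using ne by (simp add: q_def)
    have H: "power_integral \<gamma> x = (x powr q - 1) / q" for x
      using ne by (simp add: power_integral_def q_def)
    have G_bound: "(real k + 1) powr q / q \<le> G / q"
    proof -
      have "(real k + 1) powr q / q \<le> A * D + 1 / q"
        using lower by (simp add: H diff_divide_distrib)
      also have "\<dots> = G / q" using q by (simp add: G_def field_simps)
      finally show ?thesis .
    qed
    have F_bound: "F / q \<le> real k powr q / q"
    proof -
      have "F / q = a * D + (1 - q) / q" using q by (simp add: F_def q_def field_simps)
      also have "\<dots> \<le> 1 + (real k powr q - 1) / q + (1 - q) / q"
        using upper by (simp add: H)
      also have "\<dots> = real k powr q / q" using q by (simp add: field_simps)
      finally show ?thesis .
    qed
    \<comment> \<open>For \<open>\<gamma> > 1\<close> the product \<open>a q D\<close> is negative, and positivity comes from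
      \<open>F_bound\<close>, where dividing by \<open>q < 0\<close> turns the inequality round.\<close>
    have F: "F > 0"
    proof (cases "q > 0")
      case True
      then show ?thesis using a D assms(4) by (auto simp: F_def intro: add_pos_pos)
    next
      case False
      then have "real k powr q \<le> F" using F_bound q by (simp add: divide_simps split: if_splits)
      moreover have "real k powr q > 0" using k by simp
      ultimately show ?thesis by linarith
    qed
    have k_lower: "F powr inverse q \<le> real k"
      using root_le_if_divide_le [OF q _ F F_bound] k by simp
    have k_upper: "real k + 1 \<le> G powr inverse q" if "q > 0 \<or> G > 0"
      using le_root_if_divide_le [OF q _ that G_bound] by simp
    have "inverse A * inverse q * ((real k + 1) powr q - 1) \<le> D"
    proof -
      have "((real k + 1) powr q - 1) / q / A \<le> D"
        using lower A by (simp add: H pos_divide_le_eq mult.commute del: divide_divide_eq_left)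
      then show ?thesis by (simp add: divide_inverse mult_ac)
    qed
    moreover have "D \<le> inverse a * inverse q * (real k powr q - \<gamma>)"
    proof -
      have "1 + (real k powr q - 1) / q = (real k powr q - \<gamma>) / q"
        using q by (simp add: add_divide_eq_iff) (simp add: q_def)
      then have "D \<le> (real k powr q - \<gamma>) / q / a"
        using upper a by (simp add: H pos_le_divide_eq mult.commute del: divide_divide_eq_left)
      then show ?thesis by (simp add: divide_inverse mult_ac)
    qed
    moreover have "\<mu>0 * G powr (- (\<gamma> / q)) \<le> \<mu> k"
      if G: "\<gamma> < 1 \<or> G \<ge> 0"
    proof (cases "G = 0")
      case True
      \<comment> \<open>The left-hand side vanishes, since \<open>0 powr p = 0\<close> for every exponent.\<close>
      then show ?thesis using assms(3) by (simp add: mu)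
    next
      case False
      with G have "real k + 1 \<le> G powr inverse q" by (intro k_upper) (auto simp: q_def)
      then have "(G powr inverse q) powr (- \<gamma>) \<le> (real k + 1) powr (- \<gamma>)"
        using assms(4) by (intro powr_mono2') auto
      moreover have "(G powr inverse q) powr (- \<gamma>) = G powr (- (\<gamma> / q))"
        by (simp add: powr_powr divide_inverse mult.commute)
      ultimately show ?thesis using assms(3) by (simp add: mu)
    qed
    ultimately show ?power
      using k_lower k_upper mu_upper [of "F powr inverse q"]
      unfolding F_def G_def q_def by auto
  next
    assume gamma: "\<gamma> = 1"
    have lower1: "ln (real k + 1) \<le> A * D" and upper1: "a * D \<le> 1 + ln (real k)"
      using lower upper gamma by (simp_all add: power_integral_def)
    have k_lower: "exp (a * D - 1) \<le> real k"
      using upper1 k by (subst ln_ge_iff [symmetric]) auto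
    have k_upper: "real k + 1 \<le> exp (A * D)"
      using lower1 by (metis add_pos_nonneg add.commute exp_le_cancel_iff exp_ln of_nat_0_le_iff zero_less_one)
    have mu1: "\<mu> k = \<mu>0 * inverse (real k + 1)"
      using mu gamma by (simp add: powr_minus)
    have "inverse A * ln (real k + 1) \<le> D" "D \<le> inverse a * (1 + ln (real k))"
      using lower1 upper1 A a by (simp_all add: field_simps)
    moreover have "\<mu>0 * exp (- (A * D)) \<le> \<mu> k"
      unfolding mu1 exp_minus using k_upper assms(3)
      by (intro mult_left_mono le_imp_inverse_le) auto
    moreover have "\<mu> k \<le> \<mu>0 * inverse (exp (a * D - 1) + 1)"
      unfolding mu1 using k_lower assms(3)
      by (intro mult_left_mono le_imp_inverse_le) (auto intro: add_pos_pos)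
    ultimately show ?log using k_lower k_upper by simp
  qed
qed

end
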